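(* Let $\mathcal C$ be the 8-qubit Pauli stabilizer code with stabilizer generators $$X_1X_2X_5X_6,\quad X_3X_4X_5X_6,\quad X_7X_8,\quad -Z_1Z_4Z_6Z_7Z_8,\quad Z_2Z_4Z_6Z_7Z_8,\quad -Z_3Z_4,\quad -Z_5Z_6 .$$ Then $\mathcal C$ is an $[[8,1,2]]$ code (i.e. $\dim\mathcal C=2$ and its distance is $2$), and the operator $\bar T=T^{\otimes 6}\otimes K$, with $T$ acting on each of qubits $1,\dots,6$ and $K=\mathrm{diag}(1,e^{i\pi/4},e^{i\pi/4},1)$ acting on qubits $7,8$, is a fault-tolerant logical $T$ gate: it preserves $\mathcal C$ and acts on it, up to a global phase, as the logical $T$ gate with respect to the logical Pauli operator $\bar Z=Z_7Z_8$, and for every single-qubit Pauli error $E$ the propagated error $\bar TE\bar T^\dagger$ is detectable.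
   Context: $T=\mathrm{diag}(1,e^{i\pi/4})$ and $K$ is written in the computational basis $|00\rangle,|01\rangle,|10\rangle,|11\rangle$ of qubits $7,8$. The logical $T$ gate with respect to $\bar Z$ acts as $1$ on the $+1$ eigenspace of $\bar Z$ in $\mathcal C$ and as $e^{i\pi/4}$ on the $-1$ eigenspace of $\bar Z$ in $\mathcal C$. With $\Pi$ the projector onto $\mathcal C$, an operator $F$ is detectable if $\Pi F\Pi$ is proportional to $\Pi$; the distance of $\mathcal C$ is the smallest weight (number of non-identity tensor factors) of a Pauli string in $\{I,X,Y,Z\}^{\otimes 8}$ that is not detectable. *)

theory Defs
  imports "HOL-Analysis.Analysis"
begin

(* The register with qubits labelled by 'q has the computational basis 'q => bool
   (False for |0>, True for |1>), so its state space is complex ^ ('q => bool). *)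

type_synonym 'q state = "complex ^ ('q \<Rightarrow> bool)"
type_synonym 'q qop = "complex ^ ('q \<Rightarrow> bool) ^ ('q \<Rightarrow> bool)"

definition dagger :: "complex ^ 'n ^ 'm \<Rightarrow> complex ^ 'm ^ 'n" where
  "dagger A = (\<chi> i j. cnj (A $ j $ i))"

definition diag_op :: "('n \<Rightarrow> complex) \<Rightarrow> complex ^ 'n ^ 'n" where
  "diag_op d = (\<chi> i j. if i = j then d i else 0)"

datatype pauli = PI | PX | PY | PZ

fun pauli_mat :: "pauli \<Rightarrow> complex ^ bool ^ bool" where
  "pauli_mat PI = mat 1"
| "pauli_mat PX = (\<chi> a b. if a = b then 0 else 1)"
| "pauli_mat PY = (\<chi> a b. if a = b then 0 else if a then \<i> else - \<i>)"
| "pauli_mat PZ = diag_op (\<lambda>a. if a then - 1 else 1)"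

definition tensor_op :: "('q::finite \<Rightarrow> complex ^ bool ^ bool) \<Rightarrow> 'q qop" where
  "tensor_op A = (\<chi> x y. \<Prod>q\<in>UNIV. A q $ x q $ y q)"

definition pauli_op :: "('q::finite \<Rightarrow> pauli) \<Rightarrow> 'q qop" where
  "pauli_op s = tensor_op (\<lambda>q. pauli_mat (s q))"

definition weight :: "('q::finite \<Rightarrow> pauli) \<Rightarrow> nat" where
  "weight s = card {q. s q \<noteq> PI}"

definition X_on :: "'q::finite set \<Rightarrow> 'q qop" where
  "X_on S = pauli_op (\<lambda>q. if q \<in> S then PX else PI)"

definition Z_on :: "'q::finite set \<Rightarrow> 'q qop" where
  "Z_on S = pauli_op (\<lambda>q. if q \<in> S then PZ else PI)"

definition stabilizer_code :: "'q::finite qop set \<Rightarrow> 'q state set" where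
  "stabilizer_code G = {v. \<forall>g\<in>G. g *v v = v}"

(* The orthogonal projector; it exists and is unique for every complex subspace C. *)
definition projector :: "'q::finite state set \<Rightarrow> 'q qop" where
  "projector C = (THE P. dagger P = P \<and> P ** P = P \<and> range (\<lambda>v. P *v v) = C)"

definition detectable :: "'q::finite state set \<Rightarrow> 'q qop \<Rightarrow> bool" where
  "detectable C F \<longleftrightarrow> (\<exists>c. projector C ** F ** projector C = mat c ** projector C)"

(* Inf on nat is the least element, and 0 if every Pauli string is detectable. *)
definition distance :: "'q::finite state set \<Rightarrow> nat" where
  "distance C = Inf (weight ` {s. \<not> detectable C (pauli_op s)})"

(* vec.subspace and vec.dim are taken over the complex numbers, unlike subspace and dim. *)
definition is_code :: "'q::finite state set \<Rightarrow> nat \<Rightarrow> nat \<Rightarrow> nat \<Rightarrow> bool" where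
  "is_code C n k d \<longleftrightarrow>
     CARD('q) = n \<and> vec.subspace C \<and> vec.dim C = 2 ^ k \<and> distance C = d"

definition preserves :: "'q::finite qop \<Rightarrow> 'q state set \<Rightarrow> bool" where
  "preserves U C \<longleftrightarrow> (\<lambda>v. U *v v) ` C = C"

definition logical_pauli :: "'q::finite state set \<Rightarrow> ('q \<Rightarrow> pauli) \<Rightarrow> bool" where
  "logical_pauli C s \<longleftrightarrow> preserves (pauli_op s) C \<and>
     \<not> (\<exists>c. \<forall>v\<in>C. pauli_op s *v v = c *s v)"

(* This determines L on C whenever C is spanned by its intersections with the two
   eigenspaces of Zbar, as is the case for a logical Pauli operator Zbar. *)
definition logical_T :: "'q::finite state set \<Rightarrow> 'q qop \<Rightarrow> 'q qop \<Rightarrow> bool" where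
  "logical_T C Zbar L \<longleftrightarrow> preserves L C \<and>
     (\<forall>v\<in>C. Zbar *v v = v \<longrightarrow> L *v v = v) \<and>
     (\<forall>v\<in>C. Zbar *v v = - v \<longrightarrow> L *v v = cis (pi / 4) *s v)"

definition logical_T_up_to_phase :: "'q::finite state set \<Rightarrow> 'q qop \<Rightarrow> 'q qop \<Rightarrow> bool" where
  "logical_T_up_to_phase C Zbar U \<longleftrightarrow>
     (\<exists>L \<phi>. logical_T C Zbar L \<and> (\<forall>v\<in>C. U *v v = cis \<phi> *s (L *v v)))"

(* Qubits are labelled by the numeral type 8, whose elements are exactly 1, ..., 8
   (arithmetic is modulo 8, so 8 = 0 there). *)

definition code8 :: "8 state set" where
  "code8 = stabilizer_code
     {X_on {1, 2, 5, 6}, X_on {3, 4, 5, 6}, X_on {7, 8},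
      - Z_on {1, 4, 6, 7, 8}, Z_on {2, 4, 6, 7, 8}, - Z_on {3, 4}, - Z_on {5, 6}}"

definition Zbar_string :: "8 \<Rightarrow> pauli" where
  "Zbar_string = (\<lambda>q. if q \<in> {7, 8} then PZ else PI)"

definition T_gate :: "complex ^ bool ^ bool" where
  "T_gate = diag_op (\<lambda>a. if a then cis (pi / 4) else 1)"

fun K_diag :: "bool \<times> bool \<Rightarrow> complex" where
  "K_diag (False, False) = 1"
| "K_diag (False, True) = cis (pi / 4)"
| "K_diag (True, False) = cis (pi / 4)"
| "K_diag (True, True) = 1"

definition K_gate :: "complex ^ (bool \<times> bool) ^ (bool \<times> bool)" where
  "K_gate = diag_op K_diag"

definition Tbar :: "8 qop" where
  "Tbar = (\<chi> x y. (\<Prod>q\<in>{1, 2, 3, 4, 5, 6}. T_gate $ x q $ y q)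
                   * K_gate $ (x 7, x 8) $ (y 7, y 8))"

end

(* The Z-type stabilizers allow exactly 16 basis strings, and the X-type stabilizers act on them with
   two orbits of size 8, distinguished by the parity p of qubits 7 and 8. So the code is spanned by
   the two orbit sums. On allowed strings the first six bits always have weight 3, so Tbar is a
   global phase times a phase depending on p only. A flip of any single qubit leaves the allowed
   strings, while each single bit is balanced on each orbit, so all single-qubit errors are
   detectable, and conjugating them by the diagonal operator Tbar makes no difference. The operator
   Z_7 Z_8 separates the two orbits, so it is an undetectable error of weight 2. *)

theory Submission
  imports Defs
begin

section \<open>Matrix algebra: diagonal operators, adjoints and orthogonal projectors\<close>

lemma diag_op_nth: "diag_op d $ x $ y = (if x = y then d x else 0)"
  by (simp add: diag_op_def)

lemma diag_op_mult_vec_nth: "(diag_op d *v v) $ x = d x * v $ x"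
  by (simp add: matrix_vector_mult_def diag_op_nth if_distrib[of "\<lambda>c. c * _"] cong: if_cong)

lemma dagger_diag_op: "dagger (diag_op d) = diag_op (\<lambda>x. cnj (d x))"
  by (simp add: dagger_def diag_op_def vec_eq_iff)

lemma diag_op_conj_nth:
  "(diag_op d ** A ** dagger (diag_op d)) $ x $ y = d x * A $ x $ y * cnj (d y)"
  by (simp add: dagger_diag_op matrix_matrix_mult_def diag_op_nth
      if_distrib[of "\<lambda>c. c * _"] if_distrib[of "\<lambda>c. _ * c"] cong: if_cong)

lemma dagger_mult: "dagger (A ** B) = dagger B ** dagger A"
  by (simp add: dagger_def matrix_matrix_mult_def vec_eq_iff cnj_sum mult.commute)

lemma diag_op_const_mult_vec: "diag_op (\<lambda>_. c) *v v = c *s v"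
  by (simp add: vec_eq_iff diag_op_mult_vec_nth)

lemma mat_mult_vec: "(mat c ** A) *v v = c *s (A *v v :: complex ^ 'n)"
proof -
  have "mat c = diag_op (\<lambda>_. c :: complex)"
    by (simp add: mat_def diag_op_def)
  then show ?thesis
    by (metis matrix_vector_mul_assoc diag_op_const_mult_vec)
qed

lemma uminus_mult_vec: "(- A) *v v = - (A *v v :: complex ^ 'n)"
  by (simp add: matrix_vector_mult_def vec_eq_iff sum_negf)

lemma matrix_vector_mult_scale: "A *v (c *s v) = c *s (A *v v :: complex ^ 'n)"
  by (simp add: matrix_vector_mult_def vec_eq_iff sum_distrib_left mult.left_commute)

text \<open>Idempotents with equal range absorb each other: \<open>P ** Q = Q\<close> and
  \<open>Q ** P = P\<close>. Since both are self-adjoint, the adjoint of the first identity reads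
  \<open>Q ** P = Q\<close>, which with the second gives \<open>Q = P\<close>.\<close>

lemma projector_eqI:
  assumes "dagger P = P" and "P ** P = P" and "range (\<lambda>v. P *v v) = C"
  shows "projector C = P"
  unfolding projector_def
proof (rule the_equality)
  fix Q assume Q: "dagger Q = Q \<and> Q ** Q = Q \<and> range (\<lambda>v. Q *v v) = C"
  have absorb: "A ** B = B"
    if idem: "A ** A = A" and ran: "range (\<lambda>v. B *v v) \<subseteq> range (\<lambda>v. A *v v)" for A B :: "'a qop"
  proof -
    have "A *v (B *v v) = B *v v" for v
    proof -
      obtain w where "B *v v = A *v w"
        using ran by blast
      then show ?thesis
        by (simp add: matrix_vector_mul_assoc idem)
    qed
    then show ?thesis
      by (simp add: matrix_eq matrix_vector_mul_assoc)
  qed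
  have PQ: "P ** Q = Q" and QP: "Q ** P = P"
    using assms Q by (auto intro!: absorb)
  have "dagger (P ** Q) = Q ** P"
    using assms Q by (simp add: dagger_mult)
  then show "Q = P"
    using PQ QP Q by simp
qed (use assms in simp)

lemma subspace_stabilizer_code: "vec.subspace (stabilizer_code G)"
  by (auto simp: stabilizer_code_def vec.subspace_def matrix_vector_right_distrib
      matrix_vector_mult_scale)

section \<open>Pauli strings in the computational basis\<close>

lemma X_on_nth: "X_on S $ x $ y = (if y = (\<lambda>q. x q \<noteq> (q \<in> S)) then 1 else 0)"
proof (cases "y = (\<lambda>q. x q \<noteq> (q \<in> S))")
  case True
  then show ?thesis
    by (auto simp: X_on_def pauli_op_def tensor_op_def mat_def intro!: prod.neutral)
next
  case False
  then obtain q where "y q \<noteq> (x q \<noteq> (q \<in> S))"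
    by (auto simp: fun_eq_iff)
  then show ?thesis
    using False
    by (auto simp: X_on_def pauli_op_def tensor_op_def mat_def intro!: prod_zero bexI[of _ q])
qed

lemma X_on_mult_vec_nth: "(X_on S *v v) $ x = v $ (\<lambda>q. x q \<noteq> (q \<in> S))"
  by (simp add: matrix_vector_mult_def X_on_nth if_distrib[of "\<lambda>c. c * _"] cong: if_cong)

lemma Z_on_eq_diag_op: "Z_on S = diag_op (\<lambda>x. \<Prod>q\<in>S. if x q then - 1 else 1)"
proof -
  have "Z_on S $ x $ y = diag_op (\<lambda>x. \<Prod>q\<in>S. if x q then - 1 else 1) $ x $ y" for x y
  proof (cases "x = y")
    case True
    have "Z_on S $ x $ y = (\<Prod>q\<in>UNIV. if q \<in> S then if x q then - 1 else 1 else 1)"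
      unfolding Z_on_def pauli_op_def tensor_op_def True
      by (auto simp: mat_def diag_op_nth intro!: prod.cong)
    then show ?thesis
      by (simp add: True diag_op_nth prod.inter_restrict [symmetric])
  next
    case False
    then obtain q where "x q \<noteq> y q"
      by (auto simp: fun_eq_iff)
    then show ?thesis
      using False
      by (auto simp: Z_on_def pauli_op_def tensor_op_def mat_def diag_op_nth
          intro!: prod_zero bexI[of _ q])
  qed
  then show ?thesis
    by (simp add: vec_eq_iff)
qed

lemma Z_on_mult_vec_nth:
  "(Z_on S *v v) $ x = (\<Prod>q\<in>S. if x q then - 1 else 1) * v $ x"
  by (simp add: Z_on_eq_diag_op diag_op_mult_vec_nth)

lemma weight_eq_0_iff: "weight s = 0 \<longleftrightarrow> s = (\<lambda>_. PI)"
  by (auto simp: weight_def)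

lemma pauli_op_PI: "pauli_op (\<lambda>_. PI) = mat 1"
proof -
  have "X_on {} = mat 1"
    by (auto simp: vec_eq_iff X_on_nth mat_def)
  then show ?thesis
    by (simp add: X_on_def)
qed

text \<open>For \<open>PX\<close> and \<open>PY\<close> only the zero pattern of the matrix matters
  later, so both fall under \<open>flip\<close>; for \<open>PZ\<close> the signs themselves have to
  be summed, so the operator is kept exactly.\<close>

lemma weight_1_cases:
  assumes "weight E = 1"
  obtains (flip) q where "\<And>x y. y \<noteq> x(q := \<not> x q) \<Longrightarrow> pauli_op E $ x $ y = 0"
  | (phase) q where "pauli_op E = Z_on {q}"
proof -
  obtain q where q: "{q. E q \<noteq> PI} = {q}"
    using assms by (auto simp: weight_def card_1_singleton_iff)
  then have I: "E r = PI" if "r \<noteq> q" for r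
    using that by auto
  show thesis
  proof (cases "E q = PZ")
    case True
    then have "E = (\<lambda>r. if r \<in> {q} then PZ else PI)"
      using I by auto
    then show thesis
      using phase by (simp add: Z_on_def)
  next
    case False
    moreover have "E q \<noteq> PI"
      using q by auto
    ultimately have XY: "E q = PX \<or> E q = PY"
      by (cases "E q") auto
    show thesis
    proof (rule flip)
      fix x y :: "'a \<Rightarrow> bool" assume "y \<noteq> x(q := \<not> x q)"
      then obtain r where "y r \<noteq> (x(q := \<not> x q)) r"
        by (auto simp: fun_eq_iff)
      then have "pauli_mat (E r) $ x r $ y r = 0"
        using XY I[of r] by (cases "r = q") (auto simp: mat_def)
      then show "pauli_op E $ x $ y = 0"
        by (auto simp: pauli_op_def tensor_op_def intro!: prod_zero)
    qed
  qed
qed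

section \<open>The basis strings that support the code\<close>

lemma UNIV_8: "(UNIV :: 8 set) = {1, 2, 3, 4, 5, 6, 7, 8}"
  by (rule card_subset_eq [symmetric]) simp_all

lemma all_8: "(\<forall>q::8. P q) \<longleftrightarrow> P 1 \<and> P 2 \<and> P 3 \<and> P 4 \<and> P 5 \<and> P 6 \<and> P 7 \<and> P 8"
proof -
  have "(\<forall>q::8. P q) \<longleftrightarrow> (\<forall>q\<in>UNIV. P q)"
    by simp
  also have "\<dots> \<longleftrightarrow> P 1 \<and> P 2 \<and> P 3 \<and> P 4 \<and> P 5 \<and> P 6 \<and> P 7 \<and> P 8"
    unfolding UNIV_8 by simp
  finally show ?thesis .
qed

text \<open>The parity conditions of the four Z-type stabilizers, solved for bits 1, 2, 3 and 5,
  with \<open>p\<close> the parity of bits 7 and 8.\<close>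

definition words :: "bool \<Rightarrow> (8 \<Rightarrow> bool) set" where
  "words p = {x. x 1 = (\<not> x 2) \<and> x 2 = ((x 4 \<noteq> x 6) \<noteq> p) \<and> x 3 = (\<not> x 4) \<and> x 5 = (\<not> x 6)
     \<and> x 8 = (x 7 \<noteq> p)}"

text \<open>Bits 4, 6 and 7 are the free coordinates \<open>u\<close>, \<open>w\<close>,
  \<open>t\<close>; together with \<open>p\<close> they determine the rest.\<close>

definition word :: "bool \<Rightarrow> bool \<times> bool \<times> bool \<Rightarrow> 8 \<Rightarrow> bool" where
  "word p = (\<lambda>(u, w, t) q.
     if q = 1 then \<not> ((u \<noteq> w) \<noteq> p) else if q = 2 then (u \<noteq> w) \<noteq> p
     else if q = 3 then \<not> u else if q = 4 then u
     else if q = 5 then \<not> w else if q = 6 then w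
     else if q = 7 then t else t \<noteq> p)"

lemma word_simps:
  "word p (u, w, t) 1 \<longleftrightarrow> \<not> ((u \<noteq> w) \<noteq> p)" "word p (u, w, t) 2 \<longleftrightarrow> (u \<noteq> w) \<noteq> p"
  "word p (u, w, t) 3 \<longleftrightarrow> \<not> u" "word p (u, w, t) 4 \<longleftrightarrow> u"
  "word p (u, w, t) 5 \<longleftrightarrow> \<not> w" "word p (u, w, t) 6 \<longleftrightarrow> w"
  "word p (u, w, t) 7 \<longleftrightarrow> t" "word p (u, w, t) 8 \<longleftrightarrow> t \<noteq> p"
  by (simp_all add: word_def)

lemma word_in_words: "word p z \<in> words p"
  by (cases z) (simp add: words_def word_simps)

lemma words_eq: "words p = range (word p)"
proof -
  have "x = word p (x 4, x 6, x 7)" if "x \<in> words p" for x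
    using that by (simp add: words_def word_simps fun_eq_iff all_8)
  then show ?thesis
    using word_in_words by blast
qed

lemma inj_word: "inj (word p)"
proof (rule injI)
  fix a b assume eq: "word p a = word p b"
  obtain u w t u' w' t' where ab: "a = (u, w, t)" "b = (u', w', t')"
    by (cases a; cases b) auto
  have "word p (u, w, t) q = word p (u', w', t') q" for q
    using eq by (simp only: ab)
  from this[of 4] this[of 6] this[of 7] show "a = b"
    by (simp add: ab word_simps)
qed

lemma sum_words: "(\<Sum>x\<in>words p. f x) = (\<Sum>u\<in>UNIV. \<Sum>w\<in>UNIV. \<Sum>t\<in>UNIV. f (word p (u, w, t)))"
proof -
  have "(\<Sum>x\<in>words p. f x) = (\<Sum>z\<in>UNIV. f (word p z))"
    unfolding words_eq by (subst sum.reindex[OF inj_word]) simp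
  then show ?thesis
    by (simp add: sum.cartesian_product case_prod_unfold)
qed

lemma card_words: "card (words p) = 8"
  using sum_words[of "\<lambda>_. 1 :: nat" p] by simp

lemma words_parity: "x \<in> words p \<Longrightarrow> x 7 = x 8 \<longleftrightarrow> \<not> p"
  by (cases "x 7") (simp_all add: words_def)

lemma words_disjoint: "x \<in> words p \<Longrightarrow> x \<in> words p' \<longleftrightarrow> p' = p"
  by (cases p; cases p') (simp_all add: words_def)

text \<open>Every qubit occurs in some Z-type stabilizer, so one flip violates a parity condition
  that is common to both values of \<open>p'\<close>.\<close>

lemma flip_not_in_words:
  assumes "x \<in> words p"
  shows "x(q := \<not> x q) \<notin> words p'"
proof -
  have "\<forall>q. x(q := \<not> x q) \<notin> words p'"
    unfolding all_8 using assms by (cases p; cases p') (simp_all add: words_def)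
  then show ?thesis by blast
qed

text \<open>Every qubit lies in the support of some X-type stabilizer, whose flip pairs the strings
  having bit \<open>q\<close> set with those having it clear.\<close>

lemma sum_words_sign: "(\<Sum>x\<in>words p. if x q then - 1 else 1 :: complex) = 0"
proof -
  have "\<forall>q. (\<Sum>x\<in>words p. if x q then - 1 else 1 :: complex) = 0"
    unfolding all_8 sum_words UNIV_bool by (cases p) (simp_all add: word_simps)
  then show ?thesis by blast
qed

section \<open>The code space and its logical basis\<close>

definition ket :: "bool \<Rightarrow> 8 state" where
  "ket p = (\<chi> x. if x \<in> words p then 1 else 0)"

lemma ket_nth: "ket p $ x = (if x \<in> words p then 1 else 0)"
  by (simp add: ket_def)

definition logical :: "complex \<Rightarrow> complex \<Rightarrow> 8 state" where
  "logical a b = a *s ket False + b *s ket True"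

lemma logical_nth:
  "logical a b $ x = (if x \<in> words False then a else if x \<in> words True then b else 0)"
  using words_disjoint[of x] by (auto simp: logical_def ket_nth)

lemma logical_inject: "logical a b = logical c d \<longleftrightarrow> a = c \<and> b = d"
proof
  assume eq: "logical a b = logical c d"
  have "logical a b $ word p z = logical c d $ word p z" for p z
    using eq by simp
  from this[of False "(False, False, False)"] this[of True "(False, False, False)"]
  show "a = c \<and> b = d"
    using word_in_words words_disjoint[OF word_in_words] by (simp add: logical_nth)
qed simp

text \<open>In the coordinates \<open>(u, w, t)\<close> the X-type stabilizers flip
  \<open>w\<close>, both \<open>u\<close> and \<open>w\<close>, and \<open>t\<close>. These generate
  all coordinate flips, so each \<open>words p\<close> is a single orbit.\<close>

lemma word_flip:
  "word p (u, \<not> w, t) = (\<lambda>q. word p (u, w, t) q \<noteq> (q \<in> {1, 2, 5, 6}))"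
  "word p (\<not> u, \<not> w, t) = (\<lambda>q. word p (u, w, t) q \<noteq> (q \<in> {3, 4, 5, 6}))"
  "word p (u, w, \<not> t) = (\<lambda>q. word p (u, w, t) q \<noteq> (q \<in> {7, 8}))"
  unfolding fun_eq_iff all_8 by (cases u; cases w; cases t; simp add: word_simps)+

lemma words_flip_iff:
  assumes "S \<in> {{1, 2, 5, 6}, {3, 4, 5, 6}, {7, 8}}"
  shows "(\<lambda>q. x q \<noteq> (q \<in> S)) \<in> words p \<longleftrightarrow> x \<in> words p"
proof -
  have flip: "(\<lambda>q. y q \<noteq> (q \<in> S)) \<in> words p" if y_in: "y \<in> words p" for y
  proof -
    obtain u w t where "y = word p (u, w, t)"
      using y_in by (auto simp: words_eq)
    then show ?thesis
      using assms word_in_words[of p "(u, \<not> w, t)"] word_in_words[of p "(\<not> u, \<not> w, t)"]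
        word_in_words[of p "(u, w, \<not> t)"]
      unfolding word_flip(2) unfolding word_flip(1,3) by (elim insertE emptyE) simp_all
  qed
  have "(\<lambda>q. (x q \<noteq> (q \<in> S)) \<noteq> (q \<in> S)) = x"
    by auto
  then show ?thesis
    using flip[of x] flip[of "\<lambda>q. x q \<noteq> (q \<in> S)"] by argo
qed

lemma words_sign:
  assumes "x \<in> words p"
  shows "(\<Prod>q\<in>{1, 4, 6, 7, 8}. if x q then - 1 else 1 :: complex) = - 1"
    "(\<Prod>q\<in>{2, 4, 6, 7, 8}. if x q then - 1 else 1 :: complex) = 1"
    "(\<Prod>q\<in>{3, 4}. if x q then - 1 else 1 :: complex) = - 1"
    "(\<Prod>q\<in>{5, 6}. if x q then - 1 else 1 :: complex) = - 1"
proof -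
  obtain u w t where x: "x = word p (u, w, t)"
    using assms by (auto simp: words_eq)
  show "(\<Prod>q\<in>{1, 4, 6, 7, 8}. if x q then - 1 else 1 :: complex) = - 1"
    "(\<Prod>q\<in>{2, 4, 6, 7, 8}. if x q then - 1 else 1 :: complex) = 1"
    "(\<Prod>q\<in>{3, 4}. if x q then - 1 else 1 :: complex) = - 1"
    "(\<Prod>q\<in>{5, 6}. if x q then - 1 else 1 :: complex) = - 1"
    unfolding x by (cases p; cases u; cases w; cases t; simp add: word_simps)+
qed

lemma logical_in_code8: "logical a b \<in> code8"
proof -
  have X: "X_on S *v logical a b = logical a b" if "S \<in> {{1, 2, 5, 6}, {3, 4, 5, 6}, {7, 8}}" for S
    using words_flip_iff[OF that] by (simp add: vec_eq_iff X_on_mult_vec_nth logical_nth)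
  have Z: "Z_on S *v logical a b = c *s logical a b"
    if "\<And>p x. x \<in> words p \<Longrightarrow> (\<Prod>q\<in>S. if x q then - 1 else 1) = c" for S c
    using that by (auto simp: vec_eq_iff Z_on_mult_vec_nth logical_nth)
  show ?thesis
    unfolding code8_def stabilizer_code_def
    by (simp add: X Z[OF words_sign(1)] Z[OF words_sign(2)] Z[OF words_sign(3)]
        Z[OF words_sign(4)] uminus_mult_vec)
qed

text \<open>The Z-type stabilizers remove all amplitudes off the allowed strings, and the X-type
  ones make the amplitude constant on each orbit; its value at the coordinates
  \<open>(False, False, False)\<close> is the logical coefficient.\<close>

lemma code8_imp_logical:
  assumes "v \<in> code8"
  shows "\<exists>a b. v = logical a b"
proof -
  have X: "v $ (\<lambda>q. x q \<noteq> (q \<in> S)) = v $ x"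
    if "S \<in> {{1, 2, 5, 6}, {3, 4, 5, 6}, {7, 8}}" for S x
  proof -
    have "X_on S *v v = v"
      using that assms by (auto simp: code8_def stabilizer_code_def)
    then show ?thesis
      by (metis X_on_mult_vec_nth)
  qed
  have Z: "(\<Prod>q\<in>S. if x q then - 1 else 1) * v $ x = v $ x"
    if "S = {2, 4, 6, 7, 8}" for S x
  proof -
    have "Z_on S *v v = v"
      using that assms by (auto simp: code8_def stabilizer_code_def)
    then show ?thesis
      by (metis Z_on_mult_vec_nth)
  qed
  have mZ: "(\<Prod>q\<in>S. if x q then - 1 else 1) * v $ x = - v $ x"
    if "S \<in> {{1, 4, 6, 7, 8}, {3, 4}, {5, 6}}" for S x
  proof -
    have "Z_on S *v v = - v"
      using that assms by (auto simp: code8_def stabilizer_code_def uminus_mult_vec minus_equation_iff)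
    then show ?thesis
      by (metis Z_on_mult_vec_nth vector_uminus_component)
  qed
  \<comment> \<open>If all four signs were right, \<open>x\<close> would lie in
    \<open>words p\<close> for \<open>p\<close> the parity of bits 7 and 8. So some sign is wrong
    and \<open>v $ x\<close> equals its own negative.\<close>
  have zero: "v $ x = 0" if "x \<notin> words False" "x \<notin> words True" for x
    using that Z[of "{2, 4, 6, 7, 8}" x] mZ[of "{1, 4, 6, 7, 8}" x] mZ[of "{3, 4}" x] mZ[of "{5, 6}" x]
    by (auto simp: words_def split: if_splits)
  have flips: "v $ word p (u, \<not> w, t) = v $ word p (u, w, t)"
    "v $ word p (\<not> u, \<not> w, t) = v $ word p (u, w, t)"
    "v $ word p (u, w, \<not> t) = v $ word p (u, w, t)" for p u w t
    unfolding word_flip(2) unfolding word_flip(1,3) by (rule X; simp)+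
  have const: "v $ x = v $ word p (False, False, False)" if x_in: "x \<in> words p" for x p
  proof -
    obtain u w t where x: "x = word p (u, w, t)"
      using x_in by (auto simp: words_eq)
    \<comment> \<open>The chosen instances connect every triple to
      \<open>(False, False, False)\<close>: the flip of \<open>w\<close> and the joint flip of
      \<open>u\<close> and \<open>w\<close> clear those two, then the flip of \<open>t\<close>
      clears the last.\<close>
    show ?thesis
      unfolding x
      using flips(1)[of p u False t] flips(2)[of p False False t] flips(1)[of p False False t]
        flips(3)[of p False False False] flips(1)[of p True False t]
      by (cases u; cases w; cases t) auto
  qed
  have "v = logical (v $ word False (False, False, False)) (v $ word True (False, False, False))"
    by (auto simp: vec_eq_iff logical_nth zero intro!: const)
  then show ?thesis by blast
qed

lemma code8_eq: "code8 = {logical a b |a b. True}"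
  using code8_imp_logical logical_in_code8 by blast

lemma ket_in_code8: "ket p \<in> code8"
  using logical_in_code8[of "of_bool (\<not> p)" "of_bool p"] by (cases p) (simp_all add: logical_def)

lemma dim_code8: "vec.dim code8 = 2"
proof (rule vec.dim_unique)
  have ne: "ket False \<noteq> ket True"
    using logical_inject[of 1 0 0 1] by (simp add: logical_def)
  then show "card {ket False, ket True} = 2"
    by simp
  show "{ket False, ket True} \<subseteq> code8"
    using ket_in_code8 by simp
  show "code8 \<subseteq> vec.span {ket False, ket True}"
  proof
    fix v assume "v \<in> code8"
    then obtain a b where "v = a *s ket False + b *s ket True"
      by (auto simp: code8_eq logical_def)
    then show "v \<in> vec.span {ket False, ket True}"
      by (simp add: vec.span_add vec.span_scale vec.span_base)
  qed
  have "ket False \<noteq> c *s ket True" for c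
    using logical_inject[of 1 0 0 c] by (simp add: logical_def)
  moreover have "ket True \<noteq> 0"
    using logical_inject[of 0 1 0 0] by (simp add: logical_def)
  ultimately show "vec.independent {ket False, ket True}"
    using ne by (auto simp: vec.independent_insert vec.span_singleton)
qed

text \<open>For operators diagonal in the logical basis. Dividing by the nonzero factors gives an
  explicit preimage, so the image is the whole code.\<close>

lemma preserves_code8I:
  assumes "\<And>a b. U *v logical a b = logical (\<alpha> * a) (\<beta> * b)" and "\<alpha> \<noteq> 0" and "\<beta> \<noteq> 0"
  shows "preserves U code8"
  unfolding preserves_def
proof
  show "(\<lambda>v. U *v v) ` code8 \<subseteq> code8"
    using logical_in_code8 by (auto dest!: code8_imp_logical simp: assms(1))
  show "code8 \<subseteq> (\<lambda>v. U *v v) ` code8"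
  proof
    fix v assume "v \<in> code8"
    then obtain a b where "v = logical a b"
      by (auto simp: code8_eq)
    then have "v = U *v logical (a / \<alpha>) (b / \<beta>)"
      using assms by simp
    then show "v \<in> (\<lambda>v. U *v v) ` code8"
      using logical_in_code8 by blast
  qed
qed

section \<open>The code projector, detectability and the distance\<close>

definition code8_proj :: "8 qop" where
  "code8_proj = (\<chi> x y. (ket False $ x * ket False $ y + ket True $ x * ket True $ y) / 8)"

lemma code8_proj_mult_vec:
  "code8_proj *v v = logical ((\<Sum>x\<in>words False. v $ x) / 8) ((\<Sum>x\<in>words True. v $ x) / 8)"
proof -
  \<comment> \<open>The kets are real, so these sums are their inner products with \<open>v\<close>;
    the 8 in \<open>code8_proj\<close> is the squared norm of each ket.\<close>
  have "(\<Sum>x\<in>UNIV. ket p $ x * v $ x) = (\<Sum>x\<in>words p. v $ x)" for p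
    by (simp add: ket_nth if_distrib[of "\<lambda>c. c * _"] sum.inter_restrict [symmetric] cong: if_cong)
  moreover have "(code8_proj *v v) $ x = ket False $ x * (\<Sum>x\<in>UNIV. ket False $ x * v $ x) / 8
      + ket True $ x * (\<Sum>x\<in>UNIV. ket True $ x * v $ x) / 8" for x
    by (simp add: code8_proj_def matrix_vector_mult_def sum_distrib_left sum_divide_distrib
        flip: sum.distrib) (simp add: algebra_simps add_divide_distrib)
  ultimately show ?thesis
    by (simp add: vec_eq_iff logical_def mult.commute)
qed

lemma code8_proj_logical: "code8_proj *v logical a b = logical a b"
proof -
  have "(\<Sum>x\<in>words p. logical a b $ x) = 8 * (if p then b else a)" for p
    by (simp add: logical_nth words_disjoint card_words)
  then show ?thesis
    by (simp add: code8_proj_mult_vec)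
qed

lemma code8_proj_idem: "code8_proj *v (code8_proj *v v) = code8_proj *v v"
  unfolding code8_proj_mult_vec[of v] by (rule code8_proj_logical)

lemma projector_code8: "projector code8 = code8_proj"
proof (rule projector_eqI)
  show "dagger code8_proj = code8_proj"
    by (simp add: dagger_def code8_proj_def vec_eq_iff ket_nth)
  show "code8_proj ** code8_proj = code8_proj"
    by (simp add: matrix_eq code8_proj_idem flip: matrix_vector_mul_assoc)
  show "range (\<lambda>v. code8_proj *v v) = code8"
  proof
    show "range (\<lambda>v. code8_proj *v v) \<subseteq> code8"
      by (auto simp: code8_proj_mult_vec logical_in_code8)
    show "code8 \<subseteq> range (\<lambda>v. code8_proj *v v)"
      by (auto simp: code8_eq) (metis code8_proj_logical rangeI)
  qed
qed

text \<open>The double sums are the matrix elements of \<open>F\<close> between the two kets. If all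
  vanish, the compression of \<open>F\<close> to the code is zero, hence proportional to the
  projector with factor 0.\<close>

lemma detectable_code8I:
  assumes "\<And>p p'. (\<Sum>x\<in>words p. \<Sum>y\<in>words p'. F $ x $ y) = 0"
  shows "detectable code8 F"
proof -
  have "(F *v ket p) $ x = (\<Sum>y\<in>words p. F $ x $ y)" for p x
    by (simp add: matrix_vector_mult_def ket_nth if_distrib[of "\<lambda>c. _ * c"]
        sum.inter_restrict [symmetric] cong: if_cong)
  then have "code8_proj *v (F *v ket p) = 0" for p
    using assms by (simp add: code8_proj_mult_vec logical_def)
  then have "code8_proj *v (F *v logical a b) = 0" for a b
    by (simp add: logical_def matrix_vector_right_distrib matrix_vector_mult_scale)
  then have "(code8_proj ** F ** code8_proj) *v v = 0" for v
    by (simp add: code8_proj_mult_vec[of v] flip: matrix_vector_mul_assoc)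
  then have "code8_proj ** F ** code8_proj = mat 0 ** code8_proj"
    by (simp add: matrix_eq mat_mult_vec)
  then show ?thesis
    unfolding detectable_def projector_code8 by blast
qed

text \<open>Every \<open>X\<close> or \<open>Y\<close> error on one qubit leaves the support of the code, and every \<open>Z\<close> error has
  mean zero on each logical basis state; conjugation by diagonal phases changes neither fact.\<close>

lemma detectable_diag_conj:
  assumes d: "\<And>x. d x * cnj (d x) = 1" and E: "weight E = 1"
  shows "detectable code8 (diag_op d ** pauli_op E ** dagger (diag_op d))"
proof (rule detectable_code8I)
  fix p p'
  from E show "(\<Sum>x\<in>words p. \<Sum>y\<in>words p'. (diag_op d ** pauli_op E ** dagger (diag_op d)) $ x $ y) = 0"
  proof (cases rule: weight_1_cases)
    case (flip q)
    then have "pauli_op E $ x $ y = 0" if "x \<in> words p" "y \<in> words p'" for x y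
      using that flip_not_in_words by metis
    then show ?thesis
      by (simp add: diag_op_conj_nth)
  next
    case (phase q)
    have "(diag_op d ** pauli_op E ** dagger (diag_op d)) $ x $ y
        = (if x = y then if x q then - 1 else 1 else 0)" for x y
      using d[of y] by (simp add: diag_op_conj_nth phase Z_on_eq_diag_op diag_op_nth)
    then have "(\<Sum>x\<in>words p. \<Sum>y\<in>words p'. (diag_op d ** pauli_op E ** dagger (diag_op d)) $ x $ y)
        = (\<Sum>x\<in>words p. if p' = p then if x q then - 1 else 1 else 0)"
      by (simp add: words_disjoint)
    then show ?thesis
      by (cases "p' = p") (simp_all add: sum_words_sign)
  qed
qed

text \<open>The bare error is the conjugated one for the constant phase 1.\<close>

lemma detectable_weight_1: "weight E = 1 \<Longrightarrow> detectable code8 (pauli_op E)"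
proof -
  assume "weight E = 1"
  moreover have "diag_op (\<lambda>_. 1) = (mat 1 :: 8 qop)"
    by (simp add: diag_op_def mat_def)
  moreover have "dagger (mat 1) = (mat 1 :: 8 qop)"
    by (simp add: dagger_def mat_def vec_eq_iff)
  ultimately show ?thesis
    using detectable_diag_conj[of "\<lambda>_. 1" E] by simp
qed

lemma detectable_weight_0: "weight E = 0 \<Longrightarrow> detectable code8 (pauli_op E)"
proof -
  assume "weight E = 0"
  then have "projector code8 ** pauli_op E ** projector code8 = mat 1 ** projector code8"
    by (simp add: weight_eq_0_iff pauli_op_PI projector_code8 matrix_eq
        code8_proj_idem flip: matrix_vector_mul_assoc)
  then show ?thesis
    unfolding detectable_def by blast
qed

text \<open>The sign of \<open>Z_on {7, 8}\<close> is the parity of bits 7 and 8, which is the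
  logical bit.\<close>

lemma Zbar_logical: "pauli_op Zbar_string *v logical a b = logical a (- b)"
proof -
  have Zbar: "pauli_op Zbar_string = Z_on {7, 8}"
    by (simp add: Zbar_string_def Z_on_def)
  show ?thesis
    using words_parity[of _ False] words_parity[of _ True]
    by (auto simp: Zbar vec_eq_iff Z_on_mult_vec_nth logical_nth)
qed

lemma not_detectable_Zbar: "\<not> detectable code8 (pauli_op Zbar_string)"
proof
  assume "detectable code8 (pauli_op Zbar_string)"
  then obtain c where
    "code8_proj ** pauli_op Zbar_string ** code8_proj = mat c ** code8_proj"
    by (auto simp: detectable_def projector_code8)
  \<comment> \<open>A vector with both logical components nonzero separates the eigenvalues:
    proportionality would force \<open>c = 1\<close> and \<open>c = - 1\<close>.\<close>
  then have "(code8_proj ** pauli_op Zbar_string ** code8_proj) *v logical 1 1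
      = (mat c ** code8_proj) *v logical 1 1"
    by simp
  also have "\<dots> = c *s logical 1 1"
    by (simp add: mat_mult_vec code8_proj_logical)
  also have "\<dots> = logical c c"
    by (simp add: logical_def vec_eq_iff algebra_simps)
  finally have "logical 1 (- 1) = logical c c"
    by (simp add: code8_proj_logical Zbar_logical flip: matrix_vector_mul_assoc)
  then show False
    by (auto simp: logical_inject)
qed

lemma distance_code8: "distance code8 = 2"
proof -
  have "{q. Zbar_string q \<noteq> PI} = {7, 8}"
    by (auto simp: Zbar_string_def)
  then have "weight Zbar_string = 2"
    by (simp add: weight_def)
  \<comment> \<open>This gives the upper bound and also makes the set nonempty, so the default value
    0 of \<open>Inf\<close> does not arise.\<close>
  then have "2 \<in> weight ` {s. \<not> detectable code8 (pauli_op s)}"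
    using not_detectable_Zbar by force
  moreover have "2 \<le> n" if "n \<in> weight ` {s. \<not> detectable code8 (pauli_op s)}" for n
  proof (rule ccontr)
    assume "\<not> 2 \<le> n"
    then have "n = 0 \<or> n = 1"
      by auto
    then show False
      using that detectable_weight_0 detectable_weight_1 by auto
  qed
  ultimately show ?thesis
    unfolding distance_def by (rule cInf_eq_minimum)
qed

section \<open>The logical action of \<open>Tbar\<close>\<close>

definition Tbar_diag :: "(8 \<Rightarrow> bool) \<Rightarrow> complex" where
  "Tbar_diag x = (\<Prod>q\<in>{1, 2, 3, 4, 5, 6}. if x q then cis (pi / 4) else 1)
     * (if x 7 = x 8 then 1 else cis (pi / 4))"

lemma Tbar_eq_diag_op: "Tbar = diag_op Tbar_diag"
proof -
  have K: "K_diag (a, b) = (if a = b then 1 else cis (pi / 4))" for a b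
    by (cases a; cases b) simp_all
  have "Tbar $ x $ y = diag_op Tbar_diag $ x $ y" for x y
  proof (cases "x = y")
    case True
    then show ?thesis
      by (simp add: Tbar_def diag_op_nth Tbar_diag_def T_gate_def K_gate_def K)
  next
    case False
    \<comment> \<open>Split by a qubit on which \<open>x\<close> and \<open>y\<close> differ: the
      \<open>T_gate\<close> factor there vanishes, or the \<open>K_gate\<close> entry does for
      qubits 7 and 8.\<close>
    then have "\<not> (\<forall>q. x q = y q)"
      by auto
    then show ?thesis
      unfolding all_8 de_Morgan_conj using False
      by (elim disjE) (simp_all add: Tbar_def diag_op_nth T_gate_def K_gate_def)
  qed
  then show ?thesis
    by (simp add: vec_eq_iff)
qed

lemma Tbar_diag_unit: "Tbar_diag x * cnj (Tbar_diag x) = 1"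
proof -
  have "norm (Tbar_diag x) = 1"
    by (simp add: Tbar_diag_def norm_mult)
  then show ?thesis
    by (metis complex_norm_square of_real_1 power_one)
qed

text \<open>Each codeword has exactly one set bit in each of the pairs \<open>{1, 2}\<close>, \<open>{3, 4}\<close>, \<open>{5, 6}\<close>, hence
  three \<open>T\<close> phases; \<open>K\<close> supplies the relative phase, since the parity of qubits 7 and 8 is the
  logical bit.\<close>

lemma Tbar_logical:
  "Tbar *v logical a b = logical (cis (3 * pi / 4) * a) (cis (3 * pi / 4) * cis (pi / 4) * b)"
proof -
  have c3: "cis (pi / 4) * (cis (pi / 4) * cis (pi / 4)) = cis (3 * pi / 4)"
    unfolding cis_mult by (rule arg_cong[of _ _ cis]) simp
  have "Tbar_diag x = cis (3 * pi / 4) * (if p then cis (pi / 4) else 1)" if x_in: "x \<in> words p" for x p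
  proof -
    obtain u w t where x: "x = word p (u, w, t)"
      using x_in by (auto simp: words_eq)
    show ?thesis
      unfolding x c3 [symmetric] Tbar_diag_def
      by (cases p; cases u; cases w; cases t) (simp_all add: word_simps)
  qed
  from this[of _ False] this[of _ True] show ?thesis
    by (auto simp: vec_eq_iff Tbar_eq_diag_op diag_op_mult_vec_nth logical_nth)
qed

lemma logical_pauli_Zbar: "logical_pauli code8 Zbar_string"
  unfolding logical_pauli_def
proof
  show "preserves (pauli_op Zbar_string) code8"
    by (rule preserves_code8I[where \<alpha> = 1 and \<beta> = "- 1"]) (simp_all add: Zbar_logical)
  show "\<not> (\<exists>c. \<forall>v\<in>code8. pauli_op Zbar_string *v v = c *s v)"
  proof
    assume "\<exists>c. \<forall>v\<in>code8. pauli_op Zbar_string *v v = c *s v"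
    then obtain c where "pauli_op Zbar_string *v logical 1 1 = c *s logical 1 1"
      using logical_in_code8 by blast
    also have "\<dots> = logical c c"
      by (simp add: logical_def vec_eq_iff algebra_simps)
    finally show False
      by (auto simp: Zbar_logical logical_inject)
  qed
qed

lemma logical_T_Tbar: "logical_T_up_to_phase code8 (pauli_op Zbar_string) Tbar"
proof -
  \<comment> \<open>\<open>L\<close> is \<open>K_gate\<close> on qubits 7 and 8 alone; on the code
    the six \<open>T_gate\<close> factors contribute only the global phase
    \<open>cis (3 * pi / 4)\<close>.\<close>
  define L :: "8 qop" where "L = diag_op (\<lambda>x. if x 7 = x 8 then 1 else cis (pi / 4))"
  have L: "L *v logical a b = logical a (cis (pi / 4) * b)" for a b
    using words_parity[of _ False] words_parity[of _ True]
    by (auto simp: vec_eq_iff L_def diag_op_mult_vec_nth logical_nth)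
  have scale: "c *s logical a b = logical (c * a) (c * b)" for a b c
    by (simp add: logical_def vec_eq_iff algebra_simps)
  have neg: "- logical a b = logical (- a) (- b)" for a b
    by (simp add: logical_def vec_eq_iff)
  have "logical_T code8 (pauli_op Zbar_string) L"
    unfolding logical_T_def
  proof (intro conjI ballI impI)
    show "preserves L code8"
      by (rule preserves_code8I[where \<alpha> = 1 and \<beta> = "cis (pi / 4)"]) (simp_all add: L)
    fix v assume "v \<in> code8"
    then obtain a b where v: "v = logical a b"
      by (auto simp: code8_eq)
    \<comment> \<open>\<open>Zbar_string\<close> negates the second logical coefficient, so
      eigenvalue 1 forces \<open>b = 0\<close> and eigenvalue -1 forces
      \<open>a = 0\<close>.\<close>
    show "L *v v = v" if "pauli_op Zbar_string *v v = v"
      using that by (auto simp: v Zbar_logical L logical_inject)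
    show "L *v v = cis (pi / 4) *s v" if "pauli_op Zbar_string *v v = - v"
      using that by (auto simp: v Zbar_logical L logical_inject scale neg)
  qed
  moreover have "\<forall>v\<in>code8. Tbar *v v = cis (3 * pi / 4) *s (L *v v)"
    by (auto simp: code8_eq Tbar_logical L scale mult.assoc)
  ultimately show ?thesis
    unfolding logical_T_up_to_phase_def by blast
qed

theorem mainTheorem5:
  shows "is_code code8 8 1 2
    \<and> logical_pauli code8 Zbar_string
    \<and> preserves Tbar code8
    \<and> logical_T_up_to_phase code8 (pauli_op Zbar_string) Tbar
    \<and> (\<forall>E. weight E = 1 \<longrightarrow> detectable code8 (Tbar ** pauli_op E ** dagger Tbar))"
proof (intro conjI allI impI)
  have "vec.subspace code8"
    unfolding code8_def by (rule subspace_stabilizer_code)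
  then show "is_code code8 8 1 2"
    by (simp add: is_code_def dim_code8 distance_code8)
  show "preserves Tbar code8"
    by (rule preserves_code8I[OF Tbar_logical]) simp_all
  show "detectable code8 (Tbar ** pauli_op E ** dagger Tbar)" if "weight E = 1" for E
    unfolding Tbar_eq_diag_op using Tbar_diag_unit that by (rule detectable_diag_conj)
qed (rule logical_pauli_Zbar logical_T_Tbar)+

end
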